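(* Let $J$ be a set and $X,Y,Z$ be three Banach spaces. Let $\Omega\subset X\times Y$ be an open set and $F:J\times\Omega\to Z$ be a map. Let $((x_{0,t},y_{0,t}))_{t\in J}$ be a family of elements of $\Omega$ indexed by $J$. Let $\epsilon>0$, $\delta>0$, $L>0$ and $0<\alpha<1$, and for any $t\in J$ set $S_t=B(x_{0,t},\delta)\times\overline{B}(y_{0,t},\epsilon)$. Assume that: (i) for any $t\in J$, $S_t\subset\Omega$; (ii) for any $t\in J$, $F(t,x_{0,t},y_{0,t})=0$; (iii) for any $t\in J$, $F(t,\cdot,\cdot)$ is continuously differentiable on $\Omega$ (so that, in particular, $\mathrm{d}_yF(t,\cdot,\cdot)$ exists and is continuous on $\Omega$); (iv) for any $t\in J$, the linear operator $\mathrm{d}_yF(t,x_{0,t},y_{0,t}):Y\to Z$ is invertible, and its inverse $\Gamma_t=(\mathrm{d}_yF(t,x_{0,t},y_{0,t}))^{-1}$ is such that $\|\Gamma_t\|\le L$; (v) there exists $g_1:[0,\delta]\times[0,\epsilon]\to\mathbb{R}$ such that for any $r\in[0,\delta]$ and any $s\in[0,\epsilon]$, $g_1(r,\cdot)$ and $g_1(\cdot,s)$ are non-decreasing, and such that for any $t\in J$ and any $(x,y)\in S_t$, $$\|\mathrm{d}_yF(t,x,y)-\mathrm{d}_yF(t,x_{0,t},y_{0,t})\|\le g_1(\|x-x_{0,t}\|,\|y-y_{0,t}\|);$$ (vi) there exists a non-decreasing function $g_2:[0,\delta]\to\mathbb{R}$ such that for any $t\in J$ and any $x\in B(x_{0,t},\delta)$,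 $\|F(t,x,y_{0,t})\|\le g_2(\|x-x_{0,t}\|)$; (vii) $Lg_1(\delta,\epsilon)\le\alpha<1$ and $Lg_2(\delta)\le\epsilon(1-\alpha)$. Then, for any $t\in J$, there exists a unique continuously differentiable map $\phi_t:B(x_{0,t},\delta)\to\overline{B}(y_{0,t},\epsilon)$ such that: (a) $y_{0,t}=\phi_t(x_{0,t})$; (b) for any $x\in B(x_{0,t},\delta)$, $F(t,x,\phi_t(x))=0$; (c) for any $x\in B(x_{0,t},\delta)$, $\mathrm{d}_yF(t,x,\phi_t(x))$ is invertible and $$\|(\mathrm{d}_yF(t,x,\phi_t(x)))^{-1}\|\le\frac{L}{1-Lg_1(\delta,\epsilon)},$$ $$\mathrm{d}\phi_t(x)=-(\mathrm{d}_yF(t,x,\phi_t(x)))^{-1}\,\mathrm{d}_xF(t,x,\phi_t(x)),$$ where $(\mathrm{d}_yF(t,x,\phi_t(x)))^{-1}:R(t,x)\subset Z\to Y$ and $R(t,x)=\mathrm{image}(\mathrm{d}_yF(t,x,\phi_t(x)))$.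
   Context: All norms, including operator norms, are denoted $\|\cdot\|$. $B$ and $\overline{B}$ denote open and closed balls respectively. $\mathrm{d}_xF(t,x,y)$ and $\mathrm{d}_yF(t,x,y)$ are the partial (Fréchet) differentials of $F(t,\cdot,\cdot)$ with respect to $x\in X$ and $y\in Y$. *)

theory Defs
  imports "HOL-Analysis.Analysis" "HOL-Library.FuncSet"
begin

text \<open>
  The Frechet differential as an element of the normed space of bounded operators, so that
  \<open>norm\<close> is the operator norm and continuity of the differential is continuity in operator norm.
  It is only meaningful where \<open>f\<close> is differentiable.
\<close>

definition fdiff :: "('a::real_normed_vector \<Rightarrow> 'b::real_normed_vector) \<Rightarrow> 'a \<Rightarrow> ('a \<Rightarrow>\<^sub>L 'b)"
  where "fdiff f x = Blinfun (frechet_derivative f (at x))"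

definition fdiff_x ::
  "('a::real_normed_vector \<times> 'b::real_normed_vector \<Rightarrow> 'c::real_normed_vector) \<Rightarrow> 'a \<Rightarrow> 'b \<Rightarrow> ('a \<Rightarrow>\<^sub>L 'c)"
  where "fdiff_x f x y = fdiff (\<lambda>x'. f (x', y)) x"

definition fdiff_y ::
  "('a::real_normed_vector \<times> 'b::real_normed_vector \<Rightarrow> 'c::real_normed_vector) \<Rightarrow> 'a \<Rightarrow> 'b \<Rightarrow> ('b \<Rightarrow>\<^sub>L 'c)"
  where "fdiff_y f x y = fdiff (\<lambda>y'. f (x, y')) y"

text \<open>Meant for open \<open>S\<close>: the derivative at a point of \<open>S\<close> is the full one.\<close>

definition cont_differentiable_on ::
  "('a::real_normed_vector \<Rightarrow> 'b::real_normed_vector) \<Rightarrow> 'a set \<Rightarrow> bool"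
  where "cont_differentiable_on f S \<longleftrightarrow>
    (\<forall>x\<in>S. f differentiable (at x)) \<and> continuous_on S (fdiff f)"

text \<open>
  Invertible means bijective onto the whole codomain with bounded inverse; in particular the
  inverse is defined on the image of \<open>A\<close>, which is all of \<open>'b\<close>.
\<close>

definition invertible_op :: "('a::real_normed_vector \<Rightarrow>\<^sub>L 'b::real_normed_vector) \<Rightarrow> bool"
  where "invertible_op A \<longleftrightarrow>
    bij (blinfun_apply A) \<and> bounded_linear (inv (blinfun_apply A))"

definition inverse_op ::
  "('a::real_normed_vector \<Rightarrow>\<^sub>L 'b::real_normed_vector) \<Rightarrow> ('b \<Rightarrow>\<^sub>L 'a)"
  where "inverse_op A = Blinfun (inv (blinfun_apply A))"

end

theory Submission
  imports Defs
begin

text \<open>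
  Freeze \<open>x\<close> and iterate \<open>y \<mapsto> y - \<Gamma> F(x, y)\<close>, with \<open>\<Gamma>\<close> the inverse of \<open>d\<^sub>y F\<close> at the centre. Its
  differential is \<open>\<Gamma> (d\<^sub>y F(x\<^sub>0, y\<^sub>0) - d\<^sub>y F(x, y))\<close>, of norm at most \<open>L g\<^sub>1(\<delta>, \<epsilon>) < 1\<close>, and the bound
  on \<open>F(x, y\<^sub>0)\<close> makes the map send the closed \<open>\<epsilon>\<close>-ball to itself, so \<open>\<phi>(x)\<close> is its only fixed point.
  The same contraction, applied to a linear equation, inverts \<open>d\<^sub>y F(x, y)\<close> with the stated bound.
  Since \<open>F\<close> is defined near \<open>(x, \<phi>(x))\<close> even if \<open>\<phi>(x)\<close> lies on the boundary of the \<open>\<epsilon>\<close>-ball,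
  continuity of \<open>\<phi>\<close> and invertibility of \<open>d\<^sub>y F(x, \<phi>(x))\<close> give differentiability.
\<close>

section \<open>Total and partial differentials as bounded operators\<close>

lemma fdiff_works:
  assumes "f differentiable (at x)"
  shows "(f has_derivative blinfun_apply (fdiff f x)) (at x)"
proof -
  have "(f has_derivative frechet_derivative f (at x)) (at x)"
    using assms frechet_derivative_works by blast
  then show ?thesis
    unfolding fdiff_def by (simp add: bounded_linear_Blinfun_apply has_derivative_bounded_linear)
qed

lemma fdiff_eqI:
  assumes "(f has_derivative blinfun_apply D) (at x)"
  shows "fdiff f x = D"
  unfolding fdiff_def frechet_derivative_at[OF assms, symmetric]
  by (rule blinfun_apply_inverse)

lemma bounded_linear_Pair_0: "bounded_linear (\<lambda>h. (h, 0))"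
  by (intro bounded_linear_Pair bounded_linear_ident bounded_linear_zero)

lemma bounded_linear_0_Pair: "bounded_linear (\<lambda>k. (0, k))"
  by (intro bounded_linear_Pair bounded_linear_ident bounded_linear_zero)

lemma has_derivative_slice_x:
  assumes "(f has_derivative f') (at (x, y))"
  shows "((\<lambda>x'. f (x', y)) has_derivative (\<lambda>h. f' (h, 0))) (at x)"
proof -
  have "((\<lambda>x'. (x', y)) has_derivative (\<lambda>h. (h, 0))) (at x)"
    by (auto intro!: derivative_eq_intros)
  from has_derivative_compose[OF this, of f f'] assms show ?thesis by simp
qed

lemma has_derivative_slice_y:
  assumes "(f has_derivative f') (at (x, y))"
  shows "((\<lambda>y'. f (x, y')) has_derivative (\<lambda>k. f' (0, k))) (at y)"
proof -
  have "((\<lambda>y'. (x, y')) has_derivative (\<lambda>k. (0, k))) (at y)"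
    by (auto intro!: derivative_eq_intros)
  from has_derivative_compose[OF this, of f f'] assms show ?thesis by simp
qed

text \<open>Chain rule with the injection of a factor into the product. Since the right factor is a
  fixed operator, continuity of the total differential along the graph of a map passes to the
  partial ones.\<close>

lemma fdiff_x_eq:
  assumes "f differentiable (at (x, y))"
  shows "fdiff_x f x y = fdiff f (x, y) o\<^sub>L Blinfun (\<lambda>h. (h, 0))"
  unfolding fdiff_x_def
proof (rule fdiff_eqI)
  have "blinfun_apply (fdiff f (x, y) o\<^sub>L Blinfun (\<lambda>h. (h, 0))) = (\<lambda>h. fdiff f (x, y) (h, 0))"
    by (simp add: fun_eq_iff bounded_linear_Blinfun_apply[OF bounded_linear_Pair_0])
  then show "((\<lambda>x'. f (x', y)) has_derivative
      blinfun_apply (fdiff f (x, y) o\<^sub>L Blinfun (\<lambda>h. (h, 0)))) (at x)"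
    using has_derivative_slice_x[OF fdiff_works[OF assms]] by simp
qed

lemma fdiff_y_eq:
  assumes "f differentiable (at (x, y))"
  shows "fdiff_y f x y = fdiff f (x, y) o\<^sub>L Blinfun (\<lambda>k. (0, k))"
  unfolding fdiff_y_def
proof (rule fdiff_eqI)
  have "blinfun_apply (fdiff f (x, y) o\<^sub>L Blinfun (\<lambda>k. (0, k))) = (\<lambda>k. fdiff f (x, y) (0, k))"
    by (simp add: fun_eq_iff bounded_linear_Blinfun_apply[OF bounded_linear_0_Pair])
  then show "((\<lambda>y'. f (x, y')) has_derivative
      blinfun_apply (fdiff f (x, y) o\<^sub>L Blinfun (\<lambda>k. (0, k)))) (at y)"
    using has_derivative_slice_y[OF fdiff_works[OF assms]] by simp
qed

lemma fdiff_pair: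
  assumes "f differentiable (at (x, y))"
  shows "fdiff f (x, y) (h, k) = fdiff_x f x y h + fdiff_y f x y k"
proof -
  have "fdiff f (x, y) (h, k) = fdiff f (x, y) (h, 0) + fdiff f (x, y) (0, k)"
    by (simp flip: blinfun.add_right)
  then show ?thesis
    by (simp add: fdiff_x_eq[OF assms] fdiff_y_eq[OF assms]
        bounded_linear_Blinfun_apply[OF bounded_linear_Pair_0]
        bounded_linear_Blinfun_apply[OF bounded_linear_0_Pair])
qed

section \<open>Inverses of bounded operators: perturbation and continuity\<close>

lemma
  assumes "invertible_op A"
  shows inverse_op_left: "inverse_op A (A y) = y"
    and inverse_op_right: "A (inverse_op A z) = z"
proof -
  have "blinfun_apply (inverse_op A) = inv (blinfun_apply A)"
    using assms by (simp add: inverse_op_def invertible_op_def bounded_linear_Blinfun_apply)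
  then show "inverse_op A (A y) = y" "A (inverse_op A z) = z"
    using assms by (simp_all add: invertible_op_def bij_is_inj bij_is_surj surj_f_inv_f)
qed

text \<open>With \<Gamma> the inverse of \<open>A0\<close>, the operator 1 - \<Gamma> A = - \<Gamma>
  (A - A0) has norm at most q = L K < 1. This bounds \<open>A\<close> from below, whence injectivity
  and the estimate for the inverse, and Banach's fixed point theorem yields surjectivity.\<close>

lemma invertible_op_perturb:
  fixes A A0 :: "'a::banach \<Rightarrow>\<^sub>L 'b::real_normed_vector"
  assumes inv: "invertible_op A0" and L: "norm (inverse_op A0) \<le> L"
    and K: "norm (A - A0) \<le> K" and LK: "L * K < 1"
  shows "invertible_op A" and "norm (inverse_op A) \<le> L / (1 - L * K)"
proof -
  define \<Gamma> where "\<Gamma> = inverse_op A0"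
  define q where "q = L * K"
  have K0: "0 \<le> K" and L0: "0 \<le> L"
    using K L norm_ge_zero order_trans by blast+
  then have q: "0 \<le> q" "q < 1"
    using LK by (simp_all add: q_def)
  have \<Gamma>_le: "norm (\<Gamma> z) \<le> L * norm z" for z
    using norm_blinfun[of \<Gamma> z] L unfolding \<Gamma>_def
    by (meson mult_right_mono norm_ge_zero order_trans)
  have E: "norm (y - \<Gamma> (A y)) \<le> q * norm y" for y
  proof -
    have "y - \<Gamma> (A y) = - \<Gamma> ((A - A0) y)"
      using inverse_op_left[OF inv, of y] by (simp add: \<Gamma>_def blinfun.bilinear_simps)
    then have "norm (y - \<Gamma> (A y)) \<le> L * norm ((A - A0) y)"
      using \<Gamma>_le by simp
    also have "\<dots> \<le> L * (K * norm y)"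
      using norm_blinfun[of "A - A0" y] K L0
      by (meson mult_left_mono mult_right_mono norm_ge_zero order_trans)
    finally show ?thesis by (simp add: q_def)
  qed
  \<comment> \<open>Split y as (y - \<Gamma> A y) + \<Gamma> A y and absorb the term q |y| into the
    left-hand side.\<close>
  have bound: "norm y \<le> L / (1 - q) * norm (A y)" for y
  proof -
    have "norm y \<le> norm (y - \<Gamma> (A y)) + norm (\<Gamma> (A y))"
      using norm_triangle_ineq[of "y - \<Gamma> (A y)" "\<Gamma> (A y)"] by simp
    also have "\<dots> \<le> q * norm y + L * norm (A y)"
      using E \<Gamma>_le add_mono by blast
    finally show ?thesis using q by (simp add: field_simps)
  qed
  have inj: "inj (blinfun_apply A)"
  proof (rule injI)
    fix u v assume "A u = A v"
    then show "u = v" using bound[of "u - v"] by (simp add: blinfun.diff_right)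
  qed
  have surj: "\<exists>y. A y = z" for z
  proof -
    \<comment> \<open>The images of u and v differ by (u - v) - \<Gamma> A (u - v), so
      \<open>E\<close> is the contraction estimate. At a fixed point \<Gamma> (A y - z) = 0, and
      applying \<open>A0\<close> gives A y = z.\<close>
    have "\<exists>!y. y \<in> UNIV \<and> y - \<Gamma> (A y - z) = y"
    proof (rule Banach_fix[of UNIV q])
      show "\<And>u v. dist (u - \<Gamma> (A u - z)) (v - \<Gamma> (A v - z)) \<le> q * dist u v"
        using E[of "u - v" for u v] by (simp add: dist_norm blinfun.bilinear_simps algebra_simps)
    qed (use q in \<open>auto simp: complete_UNIV\<close>)
    then obtain y where "\<Gamma> (A y - z) = 0" by auto
    then have "A y = z"
      using inverse_op_right[OF inv, of "A y - z"] by (simp add: \<Gamma>_def)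
    then show ?thesis ..
  qed
  have right: "A (inv (blinfun_apply A) z) = z" for z
    using surj by (metis f_inv_into_f rangeI)
  have left: "inv (blinfun_apply A) (A y) = y" for y
    using inj by simp
  have le: "norm (inv (blinfun_apply A) z) \<le> L / (1 - q) * norm z" for z
    using bound[of "inv (blinfun_apply A) z"] right by simp
  have bl: "bounded_linear (inv (blinfun_apply A))"
  proof (rule bounded_linear_intro)
    show "inv (blinfun_apply A) (u + v) = inv (blinfun_apply A) u + inv (blinfun_apply A) v" for u v
      by (rule injD[OF inj]) (simp add: right blinfun.add_right)
    show "inv (blinfun_apply A) (c *\<^sub>R u) = c *\<^sub>R inv (blinfun_apply A) u" for c u
      by (rule injD[OF inj]) (simp add: right blinfun.scaleR_right)
    show "norm (inv (blinfun_apply A) z) \<le> norm z * (L / (1 - q))" for z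
      using le by (simp add: mult.commute)
  qed
  show "invertible_op A"
    using inj surj bl by (metis bijI invertible_op_def surjI right)
  have "norm (inverse_op A) \<le> L / (1 - q)"
    using L0 q le by (intro norm_blinfun_bound)
      (simp_all add: inverse_op_def bounded_linear_Blinfun_apply[OF bl])
  then show "norm (inverse_op A) \<le> L / (1 - L * K)" by (simp add: q_def)
qed

text \<open>The identity A(x)^-1 - A(a)^-1 = - A(x)^-1 (A(x) - A(a)) A(a)^-1 and the uniform bound
  \<open>M\<close> on the inverses control the difference by M^2 |A(x) - A(a)|.\<close>

lemma continuous_on_inverse_op:
  assumes cont: "continuous_on S A" and inv: "\<And>x. x \<in> S \<Longrightarrow> invertible_op (A x)"
    and M: "\<And>x. x \<in> S \<Longrightarrow> norm (inverse_op (A x)) \<le> M"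
  shows "continuous_on S (\<lambda>x. inverse_op (A x))"
  unfolding continuous_on_def
proof
  fix a assume a: "a \<in> S"
  have M0: "0 \<le> M" using M[OF a] norm_ge_zero order_trans by blast
  have le: "norm (inverse_op (A x) - inverse_op (A a)) \<le> M * norm (A x - A a) * M" if "x \<in> S" for x
  proof -
    have "inverse_op (A x) - inverse_op (A a)
        = - (inverse_op (A x) o\<^sub>L (A x - A a) o\<^sub>L inverse_op (A a))"
      by (rule blinfun_eqI) (simp add: blinfun.bilinear_simps inverse_op_left[OF inv[OF that]]
          inverse_op_right[OF inv[OF a]])
    then have "norm (inverse_op (A x) - inverse_op (A a))
        \<le> norm (inverse_op (A x) o\<^sub>L (A x - A a)) * norm (inverse_op (A a))"
      by (metis norm_blinfun_compose norm_minus_cancel)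
    also have "\<dots> \<le> (norm (inverse_op (A x)) * norm (A x - A a)) * norm (inverse_op (A a))"
      by (intro mult_right_mono norm_blinfun_compose norm_ge_zero)
    also have "\<dots> \<le> (M * norm (A x - A a)) * M"
      using M0 by (intro mult_mono M that a mult_nonneg_nonneg) auto
    finally show ?thesis .
  qed
  have "(A \<longlongrightarrow> A a) (at a within S)"
    using cont a by (simp add: continuous_on_def)
  then have "((\<lambda>x. A x - A a) \<longlongrightarrow> 0) (at a within S)"
    by (rule LIM_zero)
  then have lim: "((\<lambda>x. M * norm (A x - A a) * M) \<longlongrightarrow> 0) (at a within S)"
    by (intro tendsto_mult_left_zero tendsto_mult_right_zero tendsto_norm_zero)
  have "((\<lambda>x. inverse_op (A x) - inverse_op (A a)) \<longlongrightarrow> 0) (at a within S)"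
    by (rule Lim_null_comparison[OF _ lim]) (auto simp: eventually_at_filter le)
  then show "((\<lambda>x. inverse_op (A x)) \<longlongrightarrow> inverse_op (A a)) (at a within S)"
    by (rule LIM_zero_cancel)
qed

section \<open>Differentiating an implicitly defined map\<close>

text \<open>As \<open>f\<close> vanishes along the graph, its differential applied to the increment
  (u - x, \<phi> u - \<phi> x) is small relative to that increment. Applying the inverse of the
  partial differential in y turns this into smallness of the error \<open>r u\<close> of the claimed
  linear approximation. The increment of \<phi> is itself bounded through \<open>r u\<close>, so an
  absorption argument replaces an a priori Lipschitz bound.\<close>

lemma has_derivative_implicit:
  fixes \<phi> :: "'a::real_normed_vector \<Rightarrow> 'b::real_normed_vector"
    and f :: "'a \<times> 'b \<Rightarrow> 'c::real_normed_vector"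
  assumes f: "f differentiable (at (x, \<phi> x))"
    and inv: "invertible_op (fdiff_y f x (\<phi> x))"
    and cont: "isCont \<phi> x"
    and "open U" "x \<in> U" and zero: "\<And>u. u \<in> U \<Longrightarrow> f (u, \<phi> u) = 0"
  shows "(\<phi> has_derivative
    blinfun_apply (- (inverse_op (fdiff_y f x (\<phi> x)) o\<^sub>L fdiff_x f x (\<phi> x)))) (at x)"
proof -
  define \<Gamma> where "\<Gamma> = inverse_op (fdiff_y f x (\<phi> x))"
  define D where "D = \<Gamma> o\<^sub>L fdiff_x f x (\<phi> x)"
  define r where "r u = \<phi> u - \<phi> x + D (u - x)" for u
  \<comment> \<open>The 1 in \<open>C\<close> accounts for the summand |u - x| of the increment; the
    1 in \<open>M\<close> allows division by it even when \<Gamma> = 0.\<close>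
  define C where "C = 1 + norm D"
  define M where "M = 1 + norm \<Gamma>"
  have C: "C > 0" and M: "M > 0"
    using norm_ge_zero[of D] norm_ge_zero[of \<Gamma>] by (simp_all add: C_def M_def add_pos_nonneg)
  have r: "r u = \<Gamma> (fdiff f (x, \<phi> x) (u - x, \<phi> u - \<phi> x))" for u
    by (simp add: r_def D_def \<Gamma>_def fdiff_pair[OF f] blinfun.bilinear_simps inverse_op_left[OF inv])
  have "\<exists>d>0. \<forall>u. norm (u - x) < d \<longrightarrow> norm (\<phi> u - \<phi> x - (- D) (u - x)) \<le> e * norm (u - x)"
    if "e > 0" for e
  proof -
    \<comment> \<open>The bound 1/2 lets k |r u| be absorbed with a loss of a factor 2; the bound e
      / (2 C) brings what remains, 2 C k |u - x|, below e |u - x|.\<close>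
    define k where "k = min (1 / 2) (e / (2 * C))"
    have k: "0 < k" "k \<le> 1 / 2" "2 * C * k \<le> e"
      using \<open>e > 0\<close> C by (simp_all add: k_def min_def field_simps)
    from fdiff_works[OF f] k M obtain d1 where d1: "d1 > 0"
      "\<And>p. norm (p - (x, \<phi> x)) < d1 \<Longrightarrow>
         norm (f p - f (x, \<phi> x) - fdiff f (x, \<phi> x) (p - (x, \<phi> x))) \<le> k / M * norm (p - (x, \<phi> x))"
      unfolding has_derivative_at_alt by (metis divide_pos_pos)
    have "isCont (\<lambda>u. (u, \<phi> u)) x"
      using cont by (intro continuous_intros)
    then obtain d2 where d2: "d2 > 0" "\<And>u. dist u x < d2 \<Longrightarrow> dist (u, \<phi> u) (x, \<phi> x) < d1"
      using d1(1) unfolding continuous_at_eps_delta by metis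
    obtain d3 where d3: "d3 > 0" "ball x d3 \<subseteq> U"
      using \<open>open U\<close> \<open>x \<in> U\<close> open_contains_ball by blast
    have "norm (\<phi> u - \<phi> x - (- D) (u - x)) \<le> e * norm (u - x)" if u: "norm (u - x) < min d2 d3" for u
    proof -
      have "u \<in> U" using u d3(2) by (auto simp: dist_norm norm_minus_commute)
      \<comment> \<open>Both values of \<open>f\<close> in the differentiability estimate are zero,
        so only the differential is left.\<close>
      then have "norm (fdiff f (x, \<phi> x) (u - x, \<phi> u - \<phi> x)) \<le> k / M * norm (u - x, \<phi> u - \<phi> x)"
        using d1(2)[of "(u, \<phi> u)"] d2(2)[of u] u zero \<open>x \<in> U\<close> by (simp add: dist_norm)
      also have "\<dots> \<le> k / M * (norm (u - x) + norm (\<phi> u - \<phi> x))"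
        using k M by (intro mult_left_mono norm_Pair_le) auto
      finally have 1: "norm (fdiff f (x, \<phi> x) (u - x, \<phi> u - \<phi> x))
          \<le> k / M * (norm (u - x) + norm (\<phi> u - \<phi> x))" .
      have "norm (r u) \<le> norm \<Gamma> * norm (fdiff f (x, \<phi> x) (u - x, \<phi> u - \<phi> x))"
        unfolding r by (rule norm_blinfun)
      also have "\<dots> \<le> M * (k / M * (norm (u - x) + norm (\<phi> u - \<phi> x)))"
        using M by (intro mult_mono 1) (auto simp: M_def)
      finally have 2: "norm (r u) \<le> k * (norm (u - x) + norm (\<phi> u - \<phi> x))"
        using M by simp
      have "norm (\<phi> u - \<phi> x) \<le> norm (r u) + norm (D (u - x))"
        using norm_triangle_ineq4[of "r u" "D (u - x)"] by (simp add: r_def)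
      also have "\<dots> \<le> norm (r u) + norm D * norm (u - x)"
        using norm_blinfun by (intro add_left_mono)
      finally have "norm (u - x) + norm (\<phi> u - \<phi> x) \<le> norm (r u) + C * norm (u - x)"
        by (simp add: C_def algebra_simps)
      \<comment> \<open>The estimates for \<open>r u\<close> and for the increment refer to each
        other; combining them leaves k |r u| on the right, at most half of the left-hand
        side.\<close>
      with 2 k(1) have "norm (r u) \<le> k * (norm (r u) + C * norm (u - x))"
        by (meson less_imp_le mult_left_mono order_trans)
      moreover have "k * norm (r u) \<le> 1 / 2 * norm (r u)"
        using k by (intro mult_right_mono) auto
      ultimately have "norm (r u) \<le> 2 * C * k * norm (u - x)"
        by (simp add: algebra_simps)
      also have "\<dots> \<le> e * norm (u - x)"
        using k by (intro mult_right_mono) auto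
      finally show ?thesis by (simp add: r_def blinfun.minus_left)
    qed
    then show ?thesis using d2(1) d3(1) by (intro exI[of _ "min d2 d3"]) auto
  qed
  then show ?thesis
    unfolding has_derivative_at_alt D_def[symmetric] \<Gamma>_def[symmetric]
    by (simp add: blinfun.bounded_linear_right)
qed

section \<open>The quantitative implicit function theorem for a single map\<close>

text \<open>The index \<open>t\<close> is fixed and the control functions are replaced by constants
  \<open>K\<close> and \<open>m\<close>. Uniqueness is pointwise: for each x the equation has
  exactly one solution in the closed ball. The extensional space
  \<open>\<rightarrow>\<^sub>E\<close> turns this into equality of functions.\<close>

lemma quantitative_implicit_function:
  fixes f :: "'x::banach \<times> 'y::banach \<Rightarrow> 'z::banach"
  assumes "\<epsilon> > 0" "\<delta> > 0"
    and dom: "ball x0 \<delta> \<times> cball y0 \<epsilon> \<subseteq> \<Omega>"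
    and zero: "f (x0, y0) = 0"
    and C1: "cont_differentiable_on f \<Omega>"
    and inv: "invertible_op (fdiff_y f x0 y0)"
    and L: "norm (inverse_op (fdiff_y f x0 y0)) \<le> L"
    and K: "\<And>x y. x \<in> ball x0 \<delta> \<Longrightarrow> y \<in> cball y0 \<epsilon> \<Longrightarrow> norm (fdiff_y f x y - fdiff_y f x0 y0) \<le> K"
    and LK: "L * K < 1"
    and m: "\<And>x. x \<in> ball x0 \<delta> \<Longrightarrow> norm (f (x, y0)) \<le> m"
    and Lm: "L * m \<le> \<epsilon> * (1 - L * K)"
  shows "\<exists>!\<phi>. \<phi> \<in> ball x0 \<delta> \<rightarrow>\<^sub>E cball y0 \<epsilon>
           \<and> cont_differentiable_on \<phi> (ball x0 \<delta>)
           \<and> y0 = \<phi> x0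
           \<and> (\<forall>x\<in>ball x0 \<delta>. f (x, \<phi> x) = 0)
           \<and> (\<forall>x\<in>ball x0 \<delta>.
                 invertible_op (fdiff_y f x (\<phi> x))
               \<and> norm (inverse_op (fdiff_y f x (\<phi> x))) \<le> L / (1 - L * K)
               \<and> fdiff \<phi> x = - (inverse_op (fdiff_y f x (\<phi> x)) o\<^sub>L fdiff_x f x (\<phi> x)))"
proof -
  let ?B = "ball x0 \<delta>" and ?C = "cball y0 \<epsilon>"
  define \<Gamma> where "\<Gamma> = inverse_op (fdiff_y f x0 y0)"
  define q where "q = L * K"
  have centre: "x0 \<in> ?B" "y0 \<in> ?C"
    using \<open>\<epsilon> > 0\<close> \<open>\<delta> > 0\<close> by simp_all
  have K0: "0 \<le> K" and L0: "0 \<le> L"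
    using K[OF centre] L norm_ge_zero order_trans by blast+
  then have q: "0 \<le> q" "q < 1"
    using LK by (simp_all add: q_def)
  have \<Gamma>_le: "norm (\<Gamma> z) \<le> L * norm z" for z
    using norm_blinfun[of \<Gamma> z] L unfolding \<Gamma>_def
    by (meson mult_right_mono norm_ge_zero order_trans)
  have diff: "f differentiable (at (x, y))" if "x \<in> ?B" "y \<in> ?C" for x y
  proof -
    have "(x, y) \<in> \<Omega>" using dom that by blast
    then show ?thesis using C1 by (simp add: cont_differentiable_on_def)
  qed
  have D: "((\<lambda>y. f (x, y)) has_derivative blinfun_apply (fdiff_y f x y)) (at y)"
    if "x \<in> ?B" "y \<in> ?C" for x y
    unfolding fdiff_y_def
    by (rule fdiff_works, rule differentiableI,
        rule has_derivative_slice_y[OF fdiff_works[OF diff[OF that]]])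
  define T where "T x y = y - \<Gamma> (f (x, y))" for x y
  have contr: "norm (T x u - T x v) \<le> q * norm (u - v)"
    if x: "x \<in> ?B" and uv: "u \<in> ?C" "v \<in> ?C" for x u v
  \<comment> \<open>Mean value inequality on the convex closed ball. Its boundary points lie in
    \<Omega> too, where \<open>f\<close> has a full derivative that can be restricted to the
    ball.\<close>
  proof (rule differentiable_bound[of ?C "T x" "\<lambda>y k. k - \<Gamma> (fdiff_y f x y k)"])
    fix y assume y: "y \<in> ?C"
    show "(T x has_derivative (\<lambda>k. k - \<Gamma> (fdiff_y f x y k))) (at y within ?C)"
      unfolding T_def
      by (rule has_derivative_diff[OF has_derivative_ident
            bounded_linear.has_derivative[OF blinfun.bounded_linear_right
              has_derivative_at_withinI[OF D[OF x y]]]])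
    show "onorm (\<lambda>k. k - \<Gamma> (fdiff_y f x y k)) \<le> q"
    proof (rule onorm_bound[OF q(1)])
      fix k
      have "k - \<Gamma> (fdiff_y f x y k) = - \<Gamma> ((fdiff_y f x y - fdiff_y f x0 y0) k)"
        using inverse_op_left[OF inv, of k] by (simp add: \<Gamma>_def blinfun.bilinear_simps)
      then have "norm (k - \<Gamma> (fdiff_y f x y k)) \<le> L * norm ((fdiff_y f x y - fdiff_y f x0 y0) k)"
        using \<Gamma>_le by simp
      also have "\<dots> \<le> L * (K * norm k)"
        using norm_blinfun[of "fdiff_y f x y - fdiff_y f x0 y0" k] K[OF x y] L0
        by (meson mult_left_mono mult_right_mono norm_ge_zero order_trans)
      finally show "norm (k - \<Gamma> (fdiff_y f x y k)) \<le> q * norm k" by (simp add: q_def)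
    qed
  qed (use uv in auto)
  have fix_iff: "T x y = y \<longleftrightarrow> f (x, y) = 0" for x y
    using inverse_op_right[OF inv, of "f (x, y)"] by (auto simp: T_def \<Gamma>_def)
  have ex1: "\<exists>!y. y \<in> ?C \<and> f (x, y) = 0" if x: "x \<in> ?B" for x
  proof -
    have "\<exists>!y. y \<in> ?C \<and> T x y = y"
    proof (rule Banach_fix[of ?C q])
      \<comment> \<open>Comparison with \<open>T x y0\<close> gives q \<epsilon> from the
        contraction plus L m \<le> \<epsilon> (1 - q) from the displacement of the centre, in total
        \<epsilon>.\<close>
      show "T x ` ?C \<subseteq> ?C"
      proof clarify
        fix y assume y: "y \<in> ?C"
        have "norm (T x y - y0) \<le> norm (T x y - T x y0) + norm (T x y0 - y0)"
          using norm_triangle_ineq[of "T x y - T x y0" "T x y0 - y0"] by simp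
        also have "norm (T x y - T x y0) \<le> q * norm (y - y0)"
          using contr x y centre by blast
        also have "\<dots> \<le> q * \<epsilon>"
          using y q by (intro mult_left_mono) (auto simp: dist_norm norm_minus_commute)
        also have "norm (T x y0 - y0) \<le> L * norm (f (x, y0))"
          using \<Gamma>_le by (simp add: T_def)
        also have "\<dots> \<le> L * m"
          using m[OF x] L0 by (rule mult_left_mono)
        also have "\<dots> \<le> \<epsilon> * (1 - q)"
          using Lm by (simp add: q_def)
        finally show "T x y \<in> ?C"
          by (simp add: dist_norm norm_minus_commute algebra_simps)
      qed
    qed (use contr x centre q in \<open>auto simp: dist_norm complete_eq_closed\<close>)
    then show ?thesis by (simp add: fix_iff)
  qed
  \<comment> \<open>Outside the open ball the value is \<open>undefined\<close>, as extensionality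
    demands; derivatives at points of the ball do not see this.\<close>
  define \<phi> where "\<phi> = (\<lambda>x\<in>?B. THE y. y \<in> ?C \<and> f (x, y) = 0)"
  have \<phi>: "\<phi> x \<in> ?C" "f (x, \<phi> x) = 0" if "x \<in> ?B" for x
    using theI'[OF ex1[OF that]] that by (simp_all add: \<phi>_def)
  have inv\<phi>: "invertible_op (fdiff_y f x (\<phi> x))"
    and bound\<phi>: "norm (inverse_op (fdiff_y f x (\<phi> x))) \<le> L / (1 - L * K)" if "x \<in> ?B" for x
    using invertible_op_perturb[OF inv L K[OF that \<phi>(1)[OF that]] LK] by blast+
  have cont: "isCont \<phi> x" if x: "x \<in> ?B" for x
  proof -
    have le: "norm (\<phi> u - \<phi> x) \<le> L / (1 - q) * norm (f (u, \<phi> x) - f (x, \<phi> x))" if u: "u \<in> ?B" for u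
    proof -
      \<comment> \<open>Both points are compared under the same map \<open>T u\<close>: it fixes
        \<phi> u and moves \<phi> x by - \<Gamma> f(u, \<phi> x), which tends to 0 as u tends to
        x.\<close>
      have "\<phi> u - \<phi> x = (T u (\<phi> u) - T u (\<phi> x)) - \<Gamma> (f (u, \<phi> x))"
        using \<phi>(2)[OF u] by (simp add: T_def blinfun.zero_right)
      then have "norm (\<phi> u - \<phi> x) \<le> norm (T u (\<phi> u) - T u (\<phi> x)) + norm (\<Gamma> (f (u, \<phi> x)))"
        by (metis norm_triangle_ineq4)
      also have "\<dots> \<le> q * norm (\<phi> u - \<phi> x) + L * norm (f (u, \<phi> x))"
        by (intro add_mono contr \<Gamma>_le u \<phi> x)
      finally show ?thesis using q \<phi>(2)[OF x] by (simp add: field_simps)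
    qed
    have "isCont (\<lambda>u. f (u, \<phi> x)) x"
      using has_derivative_slice_x[OF fdiff_works[OF diff[OF x \<phi>(1)[OF x]]]]
      by (rule has_derivative_continuous)
    then have "((\<lambda>u. f (u, \<phi> x) - f (x, \<phi> x)) \<longlongrightarrow> 0) (at x)"
      by (simp add: isCont_def LIM_zero)
    then have lim: "((\<lambda>u. L / (1 - q) * norm (f (u, \<phi> x) - f (x, \<phi> x))) \<longlongrightarrow> 0) (at x)"
      by (intro tendsto_mult_right_zero tendsto_norm_zero)
    have "\<forall>\<^sub>F u in at x. u \<in> ?B"
      using x by (intro eventually_at_in_open') auto
    then have "\<forall>\<^sub>F u in at x. norm (\<phi> u - \<phi> x) \<le> L / (1 - q) * norm (f (u, \<phi> x) - f (x, \<phi> x))"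
      by (rule eventually_mono) (rule le)
    then have "((\<lambda>u. \<phi> u - \<phi> x) \<longlongrightarrow> 0) (at x)"
      using lim by (rule Lim_null_comparison)
    then show ?thesis by (simp add: isCont_def LIM_zero_cancel)
  qed
  have deriv: "(\<phi> has_derivative
      blinfun_apply (- (inverse_op (fdiff_y f x (\<phi> x)) o\<^sub>L fdiff_x f x (\<phi> x)))) (at x)" if "x \<in> ?B" for x
    using that by (intro has_derivative_implicit[of _ _ _ ?B] diff inv\<phi> cont \<phi>) auto
  have fdiff\<phi>: "fdiff \<phi> x = - (inverse_op (fdiff_y f x (\<phi> x)) o\<^sub>L fdiff_x f x (\<phi> x))"
    if "x \<in> ?B" for x
    by (rule fdiff_eqI[OF deriv[OF that]])
  have "continuous_on ?B \<phi>"
    by (intro continuous_at_imp_continuous_on ballI cont)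
  then have cont_fdiff: "continuous_on ?B (\<lambda>x. fdiff f (x, \<phi> x))"
    using C1 dom \<phi>(1) unfolding cont_differentiable_on_def
    by (intro continuous_on_compose2[of \<Omega> "fdiff f" ?B] continuous_intros) auto
  have cont_x: "continuous_on ?B (\<lambda>x. fdiff_x f x (\<phi> x))"
  proof (rule continuous_on_eq)
    show "continuous_on ?B (\<lambda>x. fdiff f (x, \<phi> x) o\<^sub>L Blinfun (\<lambda>h. (h, 0)))"
      using cont_fdiff by (intro continuous_intros)
  qed (metis fdiff_x_eq diff \<phi>(1))
  have cont_y: "continuous_on ?B (\<lambda>x. fdiff_y f x (\<phi> x))"
  proof (rule continuous_on_eq)
    show "continuous_on ?B (\<lambda>x. fdiff f (x, \<phi> x) o\<^sub>L Blinfun (\<lambda>k. (0, k)))"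
      using cont_fdiff by (intro continuous_intros)
  qed (metis fdiff_y_eq diff \<phi>(1))
  \<comment> \<open>The perturbation bound L / (1 - L K) is uniform in x and serves as the constant
    \<open>M\<close> of \<open>continuous_on_inverse_op\<close>.\<close>
  have "continuous_on ?B (\<lambda>x. inverse_op (fdiff_y f x (\<phi> x)))"
    using cont_y inv\<phi> bound\<phi> by (rule continuous_on_inverse_op)
  with cont_x have
    "continuous_on ?B (\<lambda>x. - (inverse_op (fdiff_y f x (\<phi> x)) o\<^sub>L fdiff_x f x (\<phi> x)))"
    by (intro continuous_intros)
  then have "continuous_on ?B (fdiff \<phi>)"
    by (rule continuous_on_eq) (simp add: fdiff\<phi>)
  moreover have "\<phi> differentiable (at x)" if "x \<in> ?B" for x
    using deriv[OF that] by (rule differentiableI)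
  ultimately have C1\<phi>: "cont_differentiable_on \<phi> ?B"
    by (simp add: cont_differentiable_on_def)
  show ?thesis
  proof (rule ex1I[of _ \<phi>], intro conjI ballI)
    show "\<phi> \<in> ?B \<rightarrow>\<^sub>E ?C"
      using \<phi>(1) by (auto simp: \<phi>_def)
    show "y0 = \<phi> x0"
      using ex1[OF centre(1)] \<phi>[OF centre(1)] centre(2) zero by blast
  next
    fix \<psi>
    assume \<psi>: "\<psi> \<in> ?B \<rightarrow>\<^sub>E ?C
           \<and> cont_differentiable_on \<psi> ?B
           \<and> y0 = \<psi> x0
           \<and> (\<forall>x\<in>?B. f (x, \<psi> x) = 0)
           \<and> (\<forall>x\<in>?B.
                 invertible_op (fdiff_y f x (\<psi> x))
               \<and> norm (inverse_op (fdiff_y f x (\<psi> x))) \<le> L / (1 - L * K)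
               \<and> fdiff \<psi> x = - (inverse_op (fdiff_y f x (\<psi> x)) o\<^sub>L fdiff_x f x (\<psi> x)))"
    show "\<psi> = \<phi>"
    \<comment> \<open>On the ball both values are the unique zero in the closed ball; off it both
      are \<open>undefined\<close>.\<close>
    proof (rule extensionalityI[of _ ?B])
      show "\<psi> \<in> extensional ?B" "\<phi> \<in> extensional ?B"
        using \<psi> by (auto simp: \<phi>_def PiE_def)
      fix x assume x: "x \<in> ?B"
      have "\<psi> x \<in> ?C" "f (x, \<psi> x) = 0"
        using \<psi> x PiE_mem by blast+
      then show "\<psi> x = \<phi> x"
        using ex1[OF x] \<phi>[OF x] by blast
    qed
  qed (use C1\<phi> \<phi> inv\<phi> bound\<phi> fdiff\<phi> in auto)
qed

section \<open>From constants to control functions, for the whole family\<close>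

theorem proposition4p24:
  fixes J :: "'j set"
    and \<Omega> :: "('x::banach \<times> 'y::banach) set"
    and F :: "'j \<Rightarrow> 'x \<times> 'y \<Rightarrow> 'z::banach"
    and x0 :: "'j \<Rightarrow> 'x" and y0 :: "'j \<Rightarrow> 'y"
    and \<epsilon> \<delta> L \<alpha> :: real
    and g1 :: "real \<Rightarrow> real \<Rightarrow> real" and g2 :: "real \<Rightarrow> real"
  assumes "open \<Omega>"
    and "\<And>t. t \<in> J \<Longrightarrow> (x0 t, y0 t) \<in> \<Omega>"
    and "\<epsilon> > 0" and "\<delta> > 0" and "L > 0" and "0 < \<alpha>" and "\<alpha> < 1"
    and i: "\<And>t. t \<in> J \<Longrightarrow> ball (x0 t) \<delta> \<times> cball (y0 t) \<epsilon> \<subseteq> \<Omega>"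
    and ii: "\<And>t. t \<in> J \<Longrightarrow> F t (x0 t, y0 t) = 0"
    and iii: "\<And>t. t \<in> J \<Longrightarrow> cont_differentiable_on (F t) \<Omega>"
    and iv: "\<And>t. t \<in> J \<Longrightarrow> invertible_op (fdiff_y (F t) (x0 t) (y0 t))"
            "\<And>t. t \<in> J \<Longrightarrow> norm (inverse_op (fdiff_y (F t) (x0 t) (y0 t))) \<le> L"
    and v: "\<And>r. r \<in> {0..\<delta>} \<Longrightarrow> mono_on {0..\<epsilon>} (\<lambda>s. g1 r s)"
           "\<And>s. s \<in> {0..\<epsilon>} \<Longrightarrow> mono_on {0..\<delta>} (\<lambda>r. g1 r s)"
           "\<And>t x y. t \<in> J \<Longrightarrow> (x, y) \<in> ball (x0 t) \<delta> \<times> cball (y0 t) \<epsilon> \<Longrightarrow>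
              norm (fdiff_y (F t) x y - fdiff_y (F t) (x0 t) (y0 t))
                \<le> g1 (norm (x - x0 t)) (norm (y - y0 t))"
    and vi: "mono_on {0..\<delta>} g2"
            "\<And>t x. t \<in> J \<Longrightarrow> x \<in> ball (x0 t) \<delta> \<Longrightarrow> norm (F t (x, y0 t)) \<le> g2 (norm (x - x0 t))"
    and vii: "L * g1 \<delta> \<epsilon> \<le> \<alpha>" "L * g2 \<delta> \<le> \<epsilon> * (1 - \<alpha>)"
  shows "\<forall>t\<in>J. \<exists>!\<phi>. \<phi> \<in> ball (x0 t) \<delta> \<rightarrow>\<^sub>E cball (y0 t) \<epsilon>
           \<and> cont_differentiable_on \<phi> (ball (x0 t) \<delta>)
           \<and> y0 t = \<phi> (x0 t)
           \<and> (\<forall>x\<in>ball (x0 t) \<delta>. F t (x, \<phi> x) = 0)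
           \<and> (\<forall>x\<in>ball (x0 t) \<delta>.
                 invertible_op (fdiff_y (F t) x (\<phi> x))
               \<and> norm (inverse_op (fdiff_y (F t) x (\<phi> x))) \<le> L / (1 - L * g1 \<delta> \<epsilon>)
               \<and> fdiff \<phi> x = - (inverse_op (fdiff_y (F t) x (\<phi> x)) o\<^sub>L fdiff_x (F t) x (\<phi> x)))"
proof
  fix t assume t: "t \<in> J"
  show "\<exists>!\<phi>. \<phi> \<in> ball (x0 t) \<delta> \<rightarrow>\<^sub>E cball (y0 t) \<epsilon>
           \<and> cont_differentiable_on \<phi> (ball (x0 t) \<delta>)
           \<and> y0 t = \<phi> (x0 t)
           \<and> (\<forall>x\<in>ball (x0 t) \<delta>. F t (x, \<phi> x) = 0)
           \<and> (\<forall>x\<in>ball (x0 t) \<delta>.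
                 invertible_op (fdiff_y (F t) x (\<phi> x))
               \<and> norm (inverse_op (fdiff_y (F t) x (\<phi> x))) \<le> L / (1 - L * g1 \<delta> \<epsilon>)
               \<and> fdiff \<phi> x = - (inverse_op (fdiff_y (F t) x (\<phi> x)) o\<^sub>L fdiff_x (F t) x (\<phi> x)))"
  \<comment> \<open>The constants are K = g1(\<delta>, \<epsilon>) and m = g2(\<delta>).
    Monotonicity replaces the actual distances by the radii, for \<open>g1\<close> first in the
    second argument and then in the first.\<close>
  proof (rule quantitative_implicit_function[where \<Omega> = \<Omega>])
    fix x assume x: "x \<in> ball (x0 t) \<delta>"
    then have r: "norm (x - x0 t) \<in> {0..\<delta>}"
      by (simp add: dist_norm norm_minus_commute)
    show "norm (F t (x, y0 t)) \<le> g2 \<delta>"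
      using vi(2)[OF t x] mono_onD[OF vi(1) r, of \<delta>] r \<open>\<delta> > 0\<close> by auto
    fix y assume y: "y \<in> cball (y0 t) \<epsilon>"
    then have s: "norm (y - y0 t) \<in> {0..\<epsilon>}"
      by (simp add: dist_norm norm_minus_commute)
    have "norm (fdiff_y (F t) x y - fdiff_y (F t) (x0 t) (y0 t))
        \<le> g1 (norm (x - x0 t)) (norm (y - y0 t))"
      using v(3)[OF t] x y by blast
    also have "\<dots> \<le> g1 (norm (x - x0 t)) \<epsilon>"
      using mono_onD[OF v(1)[OF r] s, of \<epsilon>] s \<open>\<epsilon> > 0\<close> by auto
    also have "\<dots> \<le> g1 \<delta> \<epsilon>"
      using mono_onD[OF v(2) r, of \<epsilon> \<delta>] r \<open>\<epsilon> > 0\<close> \<open>\<delta> > 0\<close> by auto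
    finally show "norm (fdiff_y (F t) x y - fdiff_y (F t) (x0 t) (y0 t)) \<le> g1 \<delta> \<epsilon>" .
  next
    \<comment> \<open>Since L g1(\<delta>, \<epsilon>) \<le> \<alpha>, the smallness condition
      stated with \<alpha> implies the one stated with the contraction constant.\<close>
    have "\<epsilon> * (1 - \<alpha>) \<le> \<epsilon> * (1 - L * g1 \<delta> \<epsilon>)"
      using vii(1) \<open>\<epsilon> > 0\<close> by simp
    then show "L * g2 \<delta> \<le> \<epsilon> * (1 - L * g1 \<delta> \<epsilon>)"
      using vii(2) by linarith
  qed (use i ii iii iv t vii(1) \<open>\<epsilon> > 0\<close> \<open>\<delta> > 0\<close> \<open>\<alpha> < 1\<close> in auto)
qed

end
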